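(* Let $n>1$ and let $\phi\colon X\to\mathfrak{u}(n)\oplus\mathfrak{gl}(n,\mathbb{C})$, where $X=\operatorname{Hom}_{\mathbb{C}}(\mathbb{C}^n,\mathbb{C}^n)\oplus\operatorname{Hom}_{\mathbb{C}}(\mathbb{C}^n,\mathbb{C}^n)$, be the map $$\phi(A,B)=\left(\tfrac{i}{2}(A^*A-BB^* ),\,BA\right).$$ Let $\mathfrak{z}=i\mathbb{R}\,\mathrm{Id}$ be the centre of $\mathfrak{u}(n)$. For each $\varepsilon\in\mathfrak{z}\otimes\mathbb{R}^3\subset\mathfrak{u}(n)\otimes\mathbb{R}^3=\mathfrak{u}(n)\oplus\mathfrak{gl}(n,\mathbb{C})$ there exist values $\varepsilon+(R,S)$ with $(R,S)\in\mathfrak{su}(n)\oplus\mathfrak{sl}(n,\mathbb{C})$ that are not in the image of $\phi$.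
   Context: $A^*$ denotes the conjugate transpose. Using a splitting $\mathbb{R}^3=\mathbb{R}\oplus\mathbb{C}$ and $\mathfrak{u}(n)\otimes\mathbb{C}=\mathfrak{gl}(n,\mathbb{C})$ one identifies $\mathfrak{u}(n)\otimes\mathbb{R}^3$ with $\mathfrak{u}(n)\oplus\mathfrak{gl}(n,\mathbb{C})$; under this identification $\mathfrak{z}\otimes\mathbb{R}^3$ is the set of pairs $(i a\,\mathrm{Id},\lambda\,\mathrm{Id})$ with $a\in\mathbb{R}$, $\lambda\in\mathbb{C}$. The map $\phi$ is the hyperkähler moment map for the action $V\cdot(A,B)=(AV^{-1},VB)$ of $U(n)$ on the flat hyperkähler vector space $X=\mathbb{H}^{n^2}$. *)

theory Defs
  imports "HOL-Analysis.Analysis"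
begin

type_synonym 'n cmat = "complex ^ 'n ^ 'n"

definition conj_transpose :: "'n::finite cmat \<Rightarrow> 'n cmat" where
  "conj_transpose A = (\<chi> i j. cnj (A $ j $ i))"

definition cscale :: "complex \<Rightarrow> 'n::finite cmat \<Rightarrow> 'n cmat" where
  "cscale c A = (\<chi> i j. c * A $ i $ j)"

definition u_alg :: "'n::finite cmat set" where
  "u_alg = {M. conj_transpose M = - M}"

definition su_alg :: "'n::finite cmat set" where
  "su_alg = {M \<in> u_alg. trace M = 0}"

definition sl_alg :: "'n::finite cmat set" where
  "sl_alg = {M. trace M = 0}"

definition centre_u :: "'n::finite cmat set" where
  "centre_u = {cscale (\<i> * complex_of_real a) (mat 1) | a. True}"

text \<open>
  For a real subspace \<open>V\<close> of \<open>u(n)\<close>, the splitting of three-space as the sum of the reals and the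
  complex numbers gives \<open>V \<otimes> R^3 = V \<oplus> (V \<otimes> C)\<close>, and the identification of \<open>u(n) \<otimes> C\<close> with
  \<open>gl(n,C)\<close> sends \<open>Y \<otimes> 1 + Z \<otimes> i\<close> to \<open>Y + i Z\<close>. So \<open>V \<otimes> R^3\<close> becomes the following set of
  pairs of matrices.
\<close>

definition tensor_R3 :: "'n::finite cmat set \<Rightarrow> ('n cmat \<times> 'n cmat) set" where
  "tensor_R3 V = {(X, Y + cscale \<i> Z) | X Y Z. X \<in> V \<and> Y \<in> V \<and> Z \<in> V}"

definition phi :: "'n::finite cmat \<times> 'n cmat \<Rightarrow> 'n cmat \<times> 'n cmat" where
  "phi = (\<lambda>(A, B).
     (cscale (\<i> / 2) (conj_transpose A ** A - B ** conj_transpose B), B ** A))"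

lemma tensor_R3_centre_u:
  "tensor_R3 (centre_u :: 'n::finite cmat set) =
     {(cscale (\<i> * complex_of_real a) (mat 1), cscale l (mat 1)) | a l. True}"
proof (intro set_eqI iffI)
  fix p :: "'n cmat \<times> 'n cmat"
  assume "p \<in> tensor_R3 centre_u"
  then obtain a b c where p: "p = (cscale (\<i> * complex_of_real a) (mat 1),
      cscale (\<i> * complex_of_real b) (mat 1) + cscale \<i> (cscale (\<i> * complex_of_real c) (mat 1)))"
    by (auto simp: tensor_R3_def centre_u_def)
  have "p = (cscale (\<i> * complex_of_real a) (mat 1), cscale (Complex (- c) b) (mat 1))"
    unfolding p by (auto simp: cscale_def vec_eq_iff complex_eq_iff mat_def)
  then show "p \<in> {(cscale (\<i> * complex_of_real a) (mat 1), cscale l (mat 1)) | a l. True}"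
    by blast
next
  fix p :: "'n cmat \<times> 'n cmat"
  assume "p \<in> {(cscale (\<i> * complex_of_real a) (mat 1), cscale l (mat 1)) | a l. True}"
  then obtain a l where p: "p = (cscale (\<i> * complex_of_real a) (mat 1), cscale l (mat 1))"
    by blast
  have "cscale l (mat 1) = cscale (\<i> * complex_of_real (Im l)) (mat 1 :: 'n cmat)
      + cscale \<i> (cscale (\<i> * complex_of_real (- Re l)) (mat 1))"
    by (auto simp: cscale_def vec_eq_iff complex_eq_iff mat_def)
  then show "p \<in> tensor_R3 centre_u"
    unfolding p tensor_R3_def centre_u_def by blast
qed

lemma tensor_R3_u_alg: "tensor_R3 (u_alg :: 'n::finite cmat set) = u_alg \<times> UNIV"
proof -
  have "\<exists>Y \<in> u_alg. \<exists>Z \<in> u_alg. M = Y + cscale \<i> Z" for M :: "'n cmat"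
  proof (intro bexI)
    let ?Y = "cscale (1/2) (M - conj_transpose M)"
    let ?Z = "cscale (- \<i>/2) (M + conj_transpose M)"
    show "M = ?Y + cscale \<i> ?Z"
      by (auto simp: cscale_def conj_transpose_def vec_eq_iff complex_eq_iff field_simps)
    show "?Y \<in> u_alg" "?Z \<in> u_alg"
      by (auto simp: u_alg_def cscale_def conj_transpose_def vec_eq_iff complex_eq_iff field_simps)
  qed
  then show ?thesis
    unfolding tensor_R3_def by blast
qed

lemma phi_in_u_gl: "phi (p :: 'n::finite cmat \<times> 'n cmat) \<in> u_alg \<times> UNIV"
  by (cases p) (auto simp: phi_def u_alg_def cscale_def conj_transpose_def vec_eq_iff
      matrix_matrix_mult_def algebra_simps)

end

(* Suppose phi (A, B) = (X, M).  The Hermitian form of - i X at x is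
   (|A x|^2 - |B^* x|^2) / 2.  If M is singular, then so is A or B: in the first case the form is
   nonpositive at some nonzero vector of ker M, in the second one it is nonnegative at some nonzero
   vector of ker M^*.  When n > 1, one can choose M with ker M and ker M^* two distinct lines, and X
   such that the form is positive on the first line and negative on the second one. *)

theory Submission
  imports Defs
begin

lemma conj_transpose_conj_transpose [simp]: "conj_transpose (conj_transpose A) = A"
  by (simp add: conj_transpose_def vec_eq_iff)

lemma cscale_mult_vec: "(cscale c A *v x) $ i = c * (A *v x) $ i"
  by (simp add: cscale_def matrix_vector_mult_def sum_distrib_left mult.assoc)

lemma conj_transpose_mult_vec:
  "(conj_transpose C *v y) $ i = (\<Sum>k\<in>UNIV. cnj (C $ k $ i) * y $ k)"
  by (simp add: matrix_vector_mult_def conj_transpose_def)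

text \<open>Moving \<open>conj_transpose C\<close> to the other side of the Hermitian inner product
  pairs \<open>C *v x\<close> with itself; in coordinates this is an exchange of two sums.\<close>

lemma hermitian_form_conj_transpose_mult:
  "(\<Sum>i\<in>UNIV. cnj (x $ i) * ((conj_transpose C ** C) *v x) $ i)
    = complex_of_real (\<Sum>k\<in>UNIV. (cmod ((C *v x) $ k))\<^sup>2)"
proof -
  have cnj_mult: "cnj ((C *v x) $ k) = (\<Sum>i\<in>UNIV. cnj (C $ k $ i) * cnj (x $ i))" for k
    by (simp add: matrix_vector_mult_def)
  have "(\<Sum>i\<in>UNIV. cnj (x $ i) * ((conj_transpose C ** C) *v x) $ i)
      = (\<Sum>i\<in>UNIV. \<Sum>k\<in>UNIV. cnj (x $ i) * (cnj (C $ k $ i) * (C *v x) $ k))"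
    by (simp add: conj_transpose_mult_vec sum_distrib_left flip: matrix_vector_mul_assoc)
  also have "\<dots> = (\<Sum>k\<in>UNIV. \<Sum>i\<in>UNIV. cnj (x $ i) * (cnj (C $ k $ i) * (C *v x) $ k))"
    by (rule sum.swap)
  also have "\<dots> = (\<Sum>k\<in>UNIV. cnj ((C *v x) $ k) * (C *v x) $ k)"
    by (simp add: cnj_mult sum_distrib_left sum_distrib_right mult_ac)
  also have "\<dots> = complex_of_real (\<Sum>k\<in>UNIV. (cmod ((C *v x) $ k))\<^sup>2)"
    by (simp add: complex_norm_square mult.commute del: of_real_power)
  finally show ?thesis .
qed

text \<open>Both terms of the first component are Gram matrices, of \<open>A\<close> and of
  \<open>conj_transpose B\<close>. The factor \<open>\<i> / 2\<close> makes the form purely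
  imaginary, so taking \<open>Im\<close> loses nothing.\<close>

lemma hermitian_form_phi:
  "Im (\<Sum>i\<in>UNIV. cnj (x $ i) * (fst (phi (A, B)) *v x) $ i)
    = ((\<Sum>k\<in>UNIV. (cmod ((A *v x) $ k))\<^sup>2)
        - (\<Sum>k\<in>UNIV. (cmod ((conj_transpose B *v x) $ k))\<^sup>2)) / 2"
proof -
  have "(\<Sum>i\<in>UNIV. cnj (x $ i) * (fst (phi (A, B)) *v x) $ i)
      = \<i> / 2 * ((\<Sum>i\<in>UNIV. cnj (x $ i) * ((conj_transpose A ** A) *v x) $ i)
        - (\<Sum>i\<in>UNIV. cnj (x $ i) *
            ((conj_transpose (conj_transpose B) ** conj_transpose B) *v x) $ i))"
    by (simp add: phi_def cscale_mult_vec matrix_vector_mult_diff_rdistrib sum_distrib_left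
        sum_subtractf [symmetric] algebra_simps)
  also have "\<dots> = \<i> / 2 * complex_of_real ((\<Sum>k\<in>UNIV. (cmod ((A *v x) $ k))\<^sup>2)
        - (\<Sum>k\<in>UNIV. (cmod ((conj_transpose B *v x) $ k))\<^sup>2))"
    by (simp only: hermitian_form_conj_transpose_mult of_real_diff)
  moreover have "Im (\<i> / 2 * complex_of_real t) = t / 2" for t
    by simp
  ultimately show ?thesis
    by (simp only:)
qed

text \<open>The zero row puts \<open>axis q 1\<close> into the kernel of
  \<open>conj_transpose M\<close>, and the form of \<open>X\<close> at this vector is the entry
  \<open>X $ q $ q\<close>. A preimage with singular \<open>A\<close> contradicts
  \<open>pos\<close>, one with invertible \<open>A\<close> contradicts \<open>neg\<close>.\<close>

lemma phi_obstruction: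
  assumes zero_row: "\<And>j. M $ q $ j = 0"
    and neg: "Im (X $ q $ q) < 0"
    and pos: "\<And>x. x \<noteq> 0 \<Longrightarrow> M *v x = 0 \<Longrightarrow> Im (\<Sum>i\<in>UNIV. cnj (x $ i) * (X *v x) $ i) > 0"
  shows "(X, M) \<notin> range phi"
proof
  assume "(X, M) \<in> range phi"
  then obtain A B where AB: "phi (A, B) = (X, M)"
    by (metis rangeE surj_pair)
  then have M: "M = B ** A" and X: "X = fst (phi (A, B))"
    by (auto simp: phi_def)
  show False
  proof (cases "\<exists>x. x \<noteq> 0 \<and> A *v x = 0")
    case True
    then obtain x where x: "x \<noteq> 0" "A *v x = 0"
      by blast
    then have "M *v x = 0"
      by (simp add: M flip: matrix_vector_mul_assoc)
    moreover have "(\<Sum>k\<in>UNIV. (cmod ((conj_transpose B *v x) $ k))\<^sup>2) \<ge> 0"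
      by (simp add: sum_nonneg)
    ultimately show False
      using pos [OF x(1)] x(2) unfolding X hermitian_form_phi by simp
  next
    case False
    then obtain A' where "A ** A' = mat 1"
      by (metis matrix_left_invertible_ker matrix_left_right_inverse)
    \<comment> \<open>Right multiplication preserves a zero row, so \<open>B\<close> inherits row
      \<open>q\<close> of \<open>M\<close> and \<open>conj_transpose B\<close> kills
      \<open>axis q 1\<close>.\<close>
    then have "B = M ** A'"
      by (simp add: M flip: matrix_mul_assoc)
    then have B: "B $ q $ j = 0" for j
      by (simp add: matrix_matrix_mult_def zero_row)
    let ?e = "axis q 1 :: complex ^ 'a"
    have "conj_transpose B *v ?e = 0"
      by (simp add: conj_transpose_mult_vec axis_def vec_eq_iff B if_distrib cong: if_cong)
    then have "Im (\<Sum>i\<in>UNIV. cnj (?e $ i) * (X *v ?e) $ i) \<ge> 0"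
      unfolding X hermitian_form_phi by (simp add: sum_nonneg)
    moreover have "(\<Sum>i\<in>UNIV. cnj (?e $ i) * (X *v ?e) $ i)
        = (\<Sum>i\<in>UNIV. if i = q then X $ q $ q else 0)"
      by (rule sum.cong) (auto simp: matrix_vector_mult_def axis_def if_distrib cong: if_cong)
    ultimately show False
      using neg by simp
  qed
qed

theorem theorem4p9:
  fixes eps :: "'n::finite cmat \<times> 'n cmat"
  assumes "CARD('n) > 1"
    and "eps \<in> tensor_R3 centre_u"
  shows "\<exists>R \<in> su_alg. \<exists>S \<in> sl_alg. eps + (R, S) \<notin> range phi"
proof -
  obtain a l where eps: "eps = (cscale (\<i> * complex_of_real a) (mat 1), cscale l (mat 1))"
    using assms(2) unfolding tensor_R3_centre_u by blast
  obtain p q :: 'n where pq: "p \<noteq> q"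
    using assms(1) by (metis (full_types) UNIV_I card_1_singleton_iff card_le_Suc0_iff_eq
        finite_class.finite_UNIV less_le_not_le One_nat_def)
  \<comment> \<open>Larger than the absolute value of \<open>a\<close>, so that adding the central
    part \<open>a\<close> cannot change the sign of \<open>r\<close> at \<open>p\<close> or of
    \<open>- r\<close> at \<open>q\<close>.\<close>
  define r where "r = 1 + \<bar>a\<bar>"
  \<comment> \<open>Solves \<open>trace S = 0\<close>: the diagonal of \<open>S\<close> sums to
    \<open>CARD('n) * (1 - l) + u - 1\<close>.\<close>
  define u where "u = 1 - of_nat CARD('n) * (1 - l)"
  \<comment> \<open>The off-diagonal entry tilts the kernel of \<open>M\<close> towards
    \<open>axis p 1\<close>: there \<open>s * x $ q = - (1 + u) * x $ p\<close>, so a large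
    \<open>s\<close> makes \<open>x $ q\<close> small. The summand 1 keeps \<open>s\<close> positive
    when \<open>1 + u = 0\<close>.\<close>
  define s where "s = (1 + cmod (1 + u)) * (r - a + 1)"
  define R :: "'n cmat" where
    "R = (\<chi> i j. if i = j then \<i> * complex_of_real (if i = p then r else if i = q then - r else 0) else 0)"
  define S :: "'n cmat" where
    "S = (\<chi> i j. (if i = j then 1 - l + (if i = p then u else 0) - (if i = q then 1 else 0) else 0)
       + (if i = p \<and> j = q then complex_of_real s else 0))"
  \<comment> \<open>\<open>X\<close> is diagonal, with \<open>a + r > 0\<close> at \<open>p\<close>
    and \<open>a - r < 0\<close> at \<open>q\<close>, times \<open>\<i>\<close>. \<open>M\<close> is
    the identity except for \<open>1 + u\<close> at \<open>(p, p)\<close>, 0 at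
    \<open>(q, q)\<close> and \<open>s\<close> at \<open>(p, q)\<close>.\<close>
  define X where "X = cscale (\<i> * complex_of_real a) (mat 1) + R"
  define M where "M = cscale l (mat 1) + S"
  have X_nth: "X $ i $ j = (if i = j then \<i> * complex_of_real
      (a + (if i = p then r else if i = q then - r else 0)) else 0)" for i j
    by (simp add: X_def R_def cscale_def mat_def algebra_simps)
  have M_nth: "M $ i $ j = (if i = j then 1 + (if i = p then u else 0) - (if i = q then 1 else 0) else 0)
       + (if i = p \<and> j = q then complex_of_real s else 0)" for i j
    by (simp add: M_def S_def cscale_def mat_def)
  have r: "a + r \<ge> 1" "r - a \<ge> 1"
    by (auto simp: r_def)
  have s: "s > 0"
    using r by (auto simp: s_def intro!: mult_pos_pos add_pos_nonneg)
  have "R \<in> su_alg"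
  proof -
    have "trace R = (\<Sum>i\<in>UNIV. (if i = p then \<i> * complex_of_real r else 0)
        + (if i = q then - \<i> * complex_of_real r else 0))"
      unfolding trace_def using pq by (intro sum.cong) (auto simp: R_def)
    then have "trace R = 0"
      by (simp add: sum.distrib)
    then show ?thesis
      by (auto simp: su_alg_def u_alg_def R_def conj_transpose_def vec_eq_iff)
  qed
  moreover have "S \<in> sl_alg"
  proof -
    have "trace S = (\<Sum>i\<in>UNIV. (1 - l) + (if i = p then u else 0) - (if i = q then 1 else 0))"
      unfolding trace_def using pq by (intro sum.cong) (auto simp: S_def)
    then show ?thesis
      by (simp add: sl_alg_def sum.distrib sum_subtractf u_def)
  qed
  moreover have "(X, M) \<notin> range phi"
  proof (rule phi_obstruction)
    show "M $ q $ j = 0" for j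
      using pq by (simp add: M_nth)
    show "Im (X $ q $ q) < 0"
      using pq r by (simp add: X_nth)
    fix x :: "complex ^ 'n"
    assume x: "x \<noteq> 0" and Mx: "M *v x = 0"
    have Mx_nth: "(M *v x) $ i = (1 + (if i = p then u else 0) - (if i = q then 1 else 0)) * x $ i
        + (if i = p then complex_of_real s * x $ q else 0)" for i
    proof -
      have "(M *v x) $ i = (\<Sum>j\<in>UNIV.
          (if j = i then (1 + (if i = p then u else 0) - (if i = q then 1 else 0)) * x $ i else 0)
          + (if j = q then (if i = p then complex_of_real s * x $ q else 0) else 0))"
        unfolding matrix_vector_mult_def vec_lambda_beta
        by (intro sum.cong) (auto simp: M_nth distrib_right)
      then show ?thesis
        by (simp add: sum.distrib)
    qed
    \<comment> \<open>Away from \<open>p\<close> and \<open>q\<close> the rows of \<open>M\<close>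
      are those of the identity. Only row \<open>p\<close> then relates the two remaining
      coordinates, so the kernel is a line.\<close>
    have supp: "x $ i = 0" if "i \<noteq> p" "i \<noteq> q" for i
      using Mx_nth [of i] that by (simp add: Mx)
    have row_p: "complex_of_real s * x $ q = - ((1 + u) * x $ p)"
      using Mx_nth [of p] pq by (simp add: Mx add_eq_0_iff)
    have xp: "x $ p \<noteq> 0"
    proof
      assume "x $ p = 0"
      moreover from this have "x $ q = 0"
        using row_p s by simp
      ultimately have "x = 0"
        using supp by (metis vec_eq_iff zero_index)
      with x show False ..
    qed
    have Xx: "(X *v x) $ i = X $ i $ i * x $ i" for i
    proof -
      have "(X *v x) $ i = (\<Sum>j\<in>UNIV. if j = i then X $ i $ i * x $ i else 0)"
        unfolding matrix_vector_mult_def vec_lambda_beta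
        by (intro sum.cong) (auto simp: X_nth)
      then show ?thesis
        by simp
    qed
    have "(\<Sum>i\<in>UNIV. cnj (x $ i) * (X *v x) $ i)
        = (\<Sum>i\<in>UNIV. (if i = p then \<i> * complex_of_real ((a + r) * (cmod (x $ p))\<^sup>2) else 0)
            + (if i = q then \<i> * complex_of_real ((a - r) * (cmod (x $ q))\<^sup>2) else 0))"
      using pq by (intro sum.cong) (auto simp: Xx X_nth supp complex_norm_square simp del: of_real_power)
    also have "\<dots> = \<i> * complex_of_real ((a + r) * (cmod (x $ p))\<^sup>2 - (r - a) * (cmod (x $ q))\<^sup>2)"
      by (simp add: sum.distrib algebra_simps)
    finally have form: "Im (\<Sum>i\<in>UNIV. cnj (x $ i) * (X *v x) $ i)
        = (a + r) * (cmod (x $ p))\<^sup>2 - (r - a) * (cmod (x $ q))\<^sup>2"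
      by (simp only: Im_i_times Re_complex_of_real)
    have "s * cmod (x $ q) = cmod (1 + u) * cmod (x $ p)"
      using arg_cong [OF row_p, of cmod] s by (simp only: norm_mult norm_minus_cancel norm_of_real abs_of_pos)
    \<comment> \<open>The summand 1 in \<open>s\<close> gives strictness, as \<open>x $ p\<close> is
      nonzero; the common factor then cancels.\<close>
    moreover have "cmod (1 + u) * cmod (x $ p) < (1 + cmod (1 + u)) * cmod (x $ p)"
      using xp by simp
    ultimately have "(1 + cmod (1 + u)) * ((r - a + 1) * cmod (x $ q)) < (1 + cmod (1 + u)) * cmod (x $ p)"
      by (simp add: s_def mult.assoc)
    moreover have "1 + cmod (1 + u) > 0"
      by (simp add: add_pos_nonneg)
    ultimately have "(r - a + 1) * cmod (x $ q) < cmod (x $ p)"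
      by simp
    then have lt: "((r - a + 1) * cmod (x $ q))\<^sup>2 < (cmod (x $ p))\<^sup>2"
      using r by (intro power_strict_mono) auto
    \<comment> \<open>Since \<open>r - a + 1 \<ge> 1\<close>, it is at most its own square, which
      brings in the squared bound \<open>lt\<close>. Then \<open>a + r \<ge> 1\<close> lets the
      positive term at \<open>p\<close> dominate.\<close>
    have "(r - a) * (cmod (x $ q))\<^sup>2 \<le> (r - a + 1)\<^sup>2 * (cmod (x $ q))\<^sup>2"
      using r self_le_power [of "r - a + 1" 2] by (intro mult_right_mono) auto
    also have "\<dots> < (cmod (x $ p))\<^sup>2"
      using lt by (simp add: power_mult_distrib)
    also have "\<dots> \<le> (a + r) * (cmod (x $ p))\<^sup>2"
      using r(1) by (simp add: mult_le_cancel_right1)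
    finally show "Im (\<Sum>i\<in>UNIV. cnj (x $ i) * (X *v x) $ i) > 0"
      unfolding form by simp
  qed
  ultimately show ?thesis
    unfolding eps X_def M_def by auto
qed

end
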